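(* Let $L\in\mathbb{R}$ and let $$u_{\infty,L}(x_1,x_2,x_3)=v(x_1,x_2,x_3)^{\frac{1+2L}{4}}\,w(x_1,x_2,x_3)^{\frac{1-2L}{4}},$$ where $$v(x_1,x_2,x_3)=(x_1^2+x_2^2)-4ix_3,\qquad w(x_1,x_2,x_3)=(x_1^2+x_2^2)+4ix_3.$$ Then $u_{\infty,L}$ is a smooth solution (smooth on $\mathbb{H}^1\setminus\{0\}$) to the Dirichlet problem $$\begin{cases}\mathcal{H}_{\infty,L}u_{\infty,L}(q)=0, & q\in\mathbb{H}^1\setminus\{0\},\\ u_{\infty,L}(q)=0, & q=0,\end{cases}$$ where $$\mathcal{H}_{\infty,L}(u)=\Delta_\infty u+iL\,\left([X_1,X_2]\|\nabla_0u\|_{\mathbb{H}}^2\right)u.$$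
   Context: The Heisenberg group $\mathbb{H}^1$ is $\mathbb{R}^3$ with coordinates $(x_1,x_2,x_3)$, group law $$(x_1,x_2,x_3)\cdot(\hat x_1,\hat x_2,\hat x_3)=\left(x_1+\hat x_1,\;x_2+\hat x_2,\;x_3+\hat x_3+\tfrac12(x_1\hat x_2-x_2\hat x_1)\right),$$ and vector fields $$X_1=\frac{\partial}{\partial x_1}-\frac{x_2}{2}\frac{\partial}{\partial x_3},\qquad X_2=\frac{\partial}{\partial x_2}+\frac{x_1}{2}\frac{\partial}{\partial x_3},\qquad X_3=\frac{\partial}{\partial x_3},$$ which satisfy $[X_1,X_2]=X_3$. An inner product, with norm $\|\cdot\|_{\mathbb{H}}$, is chosen so that $X_1,X_2,X_3$ are orthonormal. The horizontal gradient is $\nabla_0u=(X_1u,X_2u)$; for complex-valued $u$, $\|\nabla_0u\|_{\mathbb{H}}^2=X_1u\,\overline{X_1u}+X_2u\,\overline{X_2u}$. The $\infty$-Laplacian is $$\Delta_\infty u=\left(X_1\|\nabla_0u\|_{\mathbb{H}}^2\right)X_1u+\left(X_2\|\nabla_0u\|_{\mathbb{H}}^2\right)X_2u.$$ Since $v$ and $w$ have nonnegative real part and vanish only at the origin, the powers are taken with the principal branch away from the origin; the value of $u_{\infty,L}$ at the origin is understood as its limit there. *)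

theory Defs
  imports "HOL-Analysis.Analysis"
begin

text \<open>The Heisenberg group enters only through its underlying manifold and the frame
  \<open>X\<^sub>1, X\<^sub>2, X\<^sub>3\<close> of left-invariant vector fields, so the group law itself is not needed.\<close>

type_synonym heisenberg = "real^3"

text \<open>Vector fields are treated as first-order differential operators on complex-valued functions.
  \<open>vector_derivative\<close> is unspecified where the derivative does not exist.\<close>

definition partial :: "3 \<Rightarrow> (heisenberg \<Rightarrow> complex) \<Rightarrow> heisenberg \<Rightarrow> complex" where
  "partial i f x = vector_derivative (\<lambda>t. f (x + t *\<^sub>R axis i 1)) (at 0)"

definition X1 :: "(heisenberg \<Rightarrow> complex) \<Rightarrow> heisenberg \<Rightarrow> complex" where
  "X1 f x = partial 1 f x - of_real (x $ 2 / 2) * partial 3 f x"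

definition X2 :: "(heisenberg \<Rightarrow> complex) \<Rightarrow> heisenberg \<Rightarrow> complex" where
  "X2 f x = partial 2 f x + of_real (x $ 1 / 2) * partial 3 f x"

definition bracket ::
  "((heisenberg \<Rightarrow> complex) \<Rightarrow> heisenberg \<Rightarrow> complex) \<Rightarrow>
   ((heisenberg \<Rightarrow> complex) \<Rightarrow> heisenberg \<Rightarrow> complex) \<Rightarrow>
   (heisenberg \<Rightarrow> complex) \<Rightarrow> heisenberg \<Rightarrow> complex" where
  "bracket Y Z f x = Y (Z f) x - Z (Y f) x"

text \<open>The horizontal gradient, in coordinates with respect to the frame \<open>X\<^sub>1, X\<^sub>2\<close>.\<close>

definition hgrad :: "(heisenberg \<Rightarrow> complex) \<Rightarrow> heisenberg \<Rightarrow> complex \<times> complex" where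
  "hgrad u x = (X1 u x, X2 u x)"

text \<open>The squared norm for which \<open>X\<^sub>1, X\<^sub>2\<close> are orthonormal. It is real, but typed as a complex
  number so that the vector fields can be applied to it again.\<close>

definition hnorm_sq :: "complex \<times> complex \<Rightarrow> complex" where
  "hnorm_sq p = fst p * cnj (fst p) + snd p * cnj (snd p)"

definition infinity_Laplacian :: "(heisenberg \<Rightarrow> complex) \<Rightarrow> heisenberg \<Rightarrow> complex" where
  "infinity_Laplacian u x =
     X1 (\<lambda>y. hnorm_sq (hgrad u y)) x * X1 u x + X2 (\<lambda>y. hnorm_sq (hgrad u y)) x * X2 u x"

definition H_inf :: "real \<Rightarrow> (heisenberg \<Rightarrow> complex) \<Rightarrow> heisenberg \<Rightarrow> complex" where
  "H_inf L u x =
     infinity_Laplacian u x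
     + \<i> * of_real L * bracket X1 X2 (\<lambda>y. hnorm_sq (hgrad u y)) x * u x"

definition v :: "heisenberg \<Rightarrow> complex" where
  "v x = of_real ((x $ 1)^2 + (x $ 2)^2) - 4 * \<i> * of_real (x $ 3)"

definition w :: "heisenberg \<Rightarrow> complex" where
  "w x = of_real ((x $ 1)^2 + (x $ 2)^2) + 4 * \<i> * of_real (x $ 3)"

text \<open>Away from the origin \<open>powr\<close> is the principal branch. At the origin the function is
  \<^emph>\<open>defined\<close> as the limit, rather than through the convention \<open>0 powr a = 0\<close>.\<close>

definition u_inf_formula :: "real \<Rightarrow> heisenberg \<Rightarrow> complex" where
  "u_inf_formula L x = v x powr of_real ((1 + 2 * L) / 4) * w x powr of_real ((1 - 2 * L) / 4)"

definition u_inf :: "real \<Rightarrow> heisenberg \<Rightarrow> complex" where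
  "u_inf L x = (if x = 0 then Lim (at 0) (u_inf_formula L) else u_inf_formula L x)"

text \<open>\<open>C\<^sup>k\<close> and \<open>C\<^sup>\<infinity>\<close> on a set \<open>S\<close>, which is meant to be open: the derivatives are taken at \<open>x\<close>,
  not within \<open>S\<close>.\<close>

fun C_k_on :: "nat \<Rightarrow> ('a::real_normed_vector \<Rightarrow> 'b::real_normed_vector) \<Rightarrow> 'a set \<Rightarrow> bool" where
  "C_k_on 0 f S \<longleftrightarrow> continuous_on S f"
| "C_k_on (Suc k) f S \<longleftrightarrow>
     (\<forall>x\<in>S. f differentiable (at x)) \<and>
     (\<forall>h. C_k_on k (\<lambda>x. frechet_derivative f (at x) h) S)"

definition smooth_on :: "('a::real_normed_vector \<Rightarrow> 'b::real_normed_vector) \<Rightarrow> 'a set \<Rightarrow> bool" where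
  "smooth_on f S \<longleftrightarrow> (\<forall>k. C_k_on k f S)"

end

theory Submission
  imports Defs
begin

text \<open>Since \<open>w\<close> is the conjugate of \<open>v\<close>, the solution \<open>u\<close> has modulus \<open>|v|\<^bsup>1/2\<^esup>\<close>. Write \<open>D = |v|\<^sup>2\<close>,
  \<open>z = x\<^sub>1 + \<i> x\<^sub>2\<close> and \<open>z w = A + \<i> B\<close>, so that \<open>A\<^sup>2 + B\<^sup>2 = |z|\<^sup>2 D\<close>. Then
  \<open>X\<^sub>1 u = u (A + 2 \<i> L B) / D\<close> and \<open>X\<^sub>2 u = u (B - 2 \<i> L A) / D\<close>, hence
  \<open>\<parallel>\<nabla>\<^sub>0 u\<parallel>\<^sup>2 = c |z|\<^sup>2 D\<^bsup>-1/2\<^esup>\<close> with \<open>c = 1 + 4 L\<^sup>2\<close>. Applying \<open>X\<^sub>1\<close>, \<open>X\<^sub>2\<close> and \<open>[X\<^sub>1, X\<^sub>2]\<close> to this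
  function gives \<open>8 c x\<^sub>3 D\<^bsup>-3/2\<^esup>\<close> times \<open>B\<close>, \<open>-A\<close> and \<open>-2 |z|\<^sup>2\<close> respectively,
  and the terms of the equation cancel.\<close>

section \<open>The frame expressed through Frechet derivatives\<close>

lemma partial_eq_derivative:
  assumes "(f has_derivative f') (at x)"
  shows "partial i f x = f' (axis i 1)"
proof -
  have "((\<lambda>t. x + t *\<^sub>R axis i 1) has_derivative (\<lambda>t. t *\<^sub>R axis i 1)) (at (0::real))"
    by (auto intro!: derivative_eq_intros)
  from has_derivative_compose[OF this, of f f'] assms
  have "((\<lambda>t. f (x + t *\<^sub>R axis i 1)) has_derivative (\<lambda>t. f' (t *\<^sub>R axis i 1))) (at (0::real))"
    by simp
  moreover have "f' (t *\<^sub>R axis i 1) = t *\<^sub>R f' (axis i 1)" for t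
    using assms has_derivative_linear linear_cmul by blast
  ultimately have "((\<lambda>t. f (x + t *\<^sub>R axis i 1)) has_vector_derivative f' (axis i 1)) (at 0)"
    by (simp add: has_vector_derivative_def)
  then show ?thesis
    unfolding partial_def by (rule vector_derivative_at)
qed

lemma X1_eq_derivative:
  assumes "(f has_derivative f') (at x)"
  shows "X1 f x = f' (axis 1 1) - of_real (x $ 2 / 2) * f' (axis 3 1)"
  unfolding X1_def partial_eq_derivative[OF assms] ..

lemma X2_eq_derivative:
  assumes "(f has_derivative f') (at x)"
  shows "X2 f x = f' (axis 2 1) + of_real (x $ 1 / 2) * f' (axis 3 1)"
  unfolding X2_def partial_eq_derivative[OF assms] ..

text \<open>The complement of the origin is open, so agreement there is agreement near
  \<open>x\<close>. The closed forms of \<open>u_inf\<close> and of its squared gradient norm are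
  known only off the origin.\<close>

lemma has_derivative_cong_punctured:
  fixes f g :: "'a::real_normed_vector \<Rightarrow> 'b::real_normed_vector"
  assumes "(g has_derivative g') (at x)" "x \<noteq> 0" "\<And>y. y \<noteq> 0 \<Longrightarrow> f y = g y"
  shows "(f has_derivative g') (at x)"
  by (rule has_derivative_transform_within_open[OF assms(1), of "- {0}"]) (use assms in auto)

section \<open>The functions \<open>v\<close> and \<open>w\<close> and their powers\<close>

definition v_deriv :: "heisenberg \<Rightarrow> heisenberg \<Rightarrow> complex" where
  "v_deriv x h = of_real (2 * (x$1 * h$1 + x$2 * h$2)) - 4 * \<i> * of_real (h$3)"

definition w_deriv :: "heisenberg \<Rightarrow> heisenberg \<Rightarrow> complex" where
  "w_deriv x h = of_real (2 * (x$1 * h$1 + x$2 * h$2)) + 4 * \<i> * of_real (h$3)"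

lemma has_derivative_nth [derivative_intros]:
  "((\<lambda>x::real^'n. x $ i) has_derivative (\<lambda>h. h $ i)) (at x)"
  by (rule bounded_linear_imp_has_derivative[OF bounded_linear_vec_nth])

lemma v_has_derivative: "(v has_derivative v_deriv x) (at x)"
  unfolding v_def[abs_def] v_deriv_def[abs_def]
  by (rule derivative_eq_intros refl | simp add: fun_eq_iff algebra_simps)+

lemma w_has_derivative: "(w has_derivative w_deriv x) (at x)"
  unfolding w_def[abs_def] w_deriv_def[abs_def]
  by (rule derivative_eq_intros refl | simp add: fun_eq_iff algebra_simps)+

lemma heisenberg_eq_0_iff: "x = 0 \<longleftrightarrow> x$1 = 0 \<and> x$2 = 0 \<and> x$3 = (0::real)" for x :: heisenberg
  by (simp add: vec_eq_iff forall_3)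

lemma w_eq_cnj_v: "w x = cnj (v x)"
  by (simp add: v_def w_def)

lemma v_eq_0_iff: "v x = 0 \<longleftrightarrow> x = 0"
  by (auto simp: v_def complex_eq_iff heisenberg_eq_0_iff sum_power2_eq_zero_iff)

text \<open>\<open>Re (v x)\<close> is a sum of squares, so meeting the branch cut would force
  \<open>v x = 0\<close>. Hence the principal power is differentiable at \<open>v x\<close>.\<close>

lemma v_notin_nonpos_Reals:
  assumes "x \<noteq> 0"
  shows "v x \<notin> \<real>\<^sub>\<le>\<^sub>0"
proof
  assume "v x \<in> \<real>\<^sub>\<le>\<^sub>0"
  then have "Re (v x) \<le> 0" "Im (v x) = 0"
    by (auto simp: complex_nonpos_Reals_iff)
  then have "v x = 0"
    using sum_power2_ge_zero[of "x$1" "x$2"] by (simp add: v_def complex_eq_iff antisym)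
  with assms show False
    by (simp add: v_eq_0_iff)
qed

lemma w_notin_nonpos_Reals: "x \<noteq> 0 \<Longrightarrow> w x \<notin> \<real>\<^sub>\<le>\<^sub>0"
  using v_notin_nonpos_Reals[of x] by (auto simp: w_eq_cnj_v complex_nonpos_Reals_iff)

lemma w_eq_0_iff: "w x = 0 \<longleftrightarrow> x = 0"
  by (simp add: w_eq_cnj_v v_eq_0_iff)

text \<open>Written as the power times a logarithmic derivative, so that the product rule yields a
  multiple of \<open>u_inf_formula L x\<close>.\<close>

lemma powr_has_derivative_compose:
  fixes f :: "'a::real_normed_vector \<Rightarrow> complex"
  assumes "(f has_derivative f') (at x)" "f x \<notin> \<real>\<^sub>\<le>\<^sub>0"
  shows "((\<lambda>y. f y powr s) has_derivative (\<lambda>h. f x powr s * (s * f' h / f x))) (at x)"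
proof -
  have "f x \<noteq> 0" using assms(2) by auto
  have "((\<lambda>z. z powr s) has_derivative (*) (s * f x powr (s - 1))) (at (f x))"
    using has_field_derivative_powr[OF assms(2)] by (simp add: has_field_derivative_def)
  from has_derivative_compose[OF assms(1) this] show ?thesis
    using \<open>f x \<noteq> 0\<close> by (simp add: powr_diff mult_ac)
qed

lemma u_inf_formula_has_derivative:
  assumes "x \<noteq> 0"
  shows "(u_inf_formula L has_derivative
    (\<lambda>h. u_inf_formula L x * (of_real ((1 + 2 * L) / 4) * v_deriv x h / v x
           + of_real ((1 - 2 * L) / 4) * w_deriv x h / w x))) (at x)"
  unfolding u_inf_formula_def[abs_def]
  by (rule has_derivative_eq_rhs[OF has_derivative_mult[OF
        powr_has_derivative_compose[OF v_has_derivative v_notin_nonpos_Reals[OF assms]]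
        powr_has_derivative_compose[OF w_has_derivative w_notin_nonpos_Reals[OF assms]]]])
     (simp add: fun_eq_iff algebra_simps)

section \<open>Smoothness away from the origin\<close>

lemma inverse_v_has_derivative:
  assumes "x \<noteq> 0"
  shows "((\<lambda>x. inverse (v x)) has_derivative
    (\<lambda>h. - (v_deriv x h * (inverse (v x) * inverse (v x))))) (at x)"
  by (rule has_derivative_eq_rhs[OF Deriv.has_derivative_inverse[OF _ v_has_derivative]])
     (use assms in \<open>auto simp: v_eq_0_iff mult_ac\<close>)

lemma inverse_w_has_derivative:
  assumes "x \<noteq> 0"
  shows "((\<lambda>x. inverse (w x)) has_derivative
    (\<lambda>h. - (w_deriv x h * (inverse (w x) * inverse (w x))))) (at x)"
  by (rule has_derivative_eq_rhs[OF Deriv.has_derivative_inverse[OF _ w_has_derivative]])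
     (use assms in \<open>auto simp: w_eq_0_iff mult_ac\<close>)

text \<open>An algebra of functions, closed under directional derivatives away from the origin,
  that contains the solution; membership therefore gives smoothness.\<close>

inductive_set u_algebra :: "real \<Rightarrow> (heisenberg \<Rightarrow> complex) set" for L where
  const: "(\<lambda>x. c) \<in> u_algebra L"
| coord: "(\<lambda>x. of_real (x $ i)) \<in> u_algebra L"
| formula: "u_inf_formula L \<in> u_algebra L"
| inverse_v: "(\<lambda>x. inverse (v x)) \<in> u_algebra L"
| inverse_w: "(\<lambda>x. inverse (w x)) \<in> u_algebra L"
| add: "f \<in> u_algebra L \<Longrightarrow> g \<in> u_algebra L \<Longrightarrow> (\<lambda>x. f x + g x) \<in> u_algebra L"
| mult: "f \<in> u_algebra L \<Longrightarrow> g \<in> u_algebra L \<Longrightarrow> (\<lambda>x. f x * g x) \<in> u_algebra L"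

lemma u_algebra_minus: "f \<in> u_algebra L \<Longrightarrow> (\<lambda>x. - f x) \<in> u_algebra L"
  using u_algebra.mult[OF u_algebra.const[of "-1"]] by simp

lemma v_deriv_in_u_algebra: "(\<lambda>x. v_deriv x h) \<in> u_algebra L"
proof -
  \<comment> \<open>For fixed \<open>h\<close> the derivative is affine in the coordinates; this
    arrangement matches the generators.\<close>
  have "(\<lambda>x. of_real (2 * h$1) * of_real (x$1) + of_real (2 * h$2) * of_real (x$2)
          + (- 4 * \<i> * of_real (h$3))) \<in> u_algebra L"
    by (intro u_algebra.intros)
  also have "(\<lambda>x. of_real (2 * h$1) * of_real (x$1) + of_real (2 * h$2) * of_real (x$2)
          + (- 4 * \<i> * of_real (h$3))) = (\<lambda>x. v_deriv x h)"
    by (simp add: fun_eq_iff v_deriv_def algebra_simps)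
  finally show ?thesis .
qed

lemma w_deriv_in_u_algebra: "(\<lambda>x. w_deriv x h) \<in> u_algebra L"
proof -
  have "(\<lambda>x. of_real (2 * h$1) * of_real (x$1) + of_real (2 * h$2) * of_real (x$2)
          + 4 * \<i> * of_real (h$3)) \<in> u_algebra L"
    by (intro u_algebra.intros)
  also have "(\<lambda>x. of_real (2 * h$1) * of_real (x$1) + of_real (2 * h$2) * of_real (x$2)
          + 4 * \<i> * of_real (h$3)) = (\<lambda>x. w_deriv x h)"
    by (simp add: fun_eq_iff w_deriv_def algebra_simps)
  finally show ?thesis .
qed

text \<open>One \<open>f'\<close> serves all points, so for fixed \<open>h\<close> the directional
  derivative is again a member and the argument iterates. Reciprocals are generators because the
  logarithmic derivative of the formula divides by \<open>v\<close> and \<open>w\<close>.\<close>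

lemma u_algebra_derivative:
  assumes "f \<in> u_algebra L"
  shows "\<exists>f'. (\<forall>x. x \<noteq> 0 \<longrightarrow> (f has_derivative f' x) (at x)) \<and> (\<forall>h. (\<lambda>x. f' x h) \<in> u_algebra L)"
  using assms
proof induction
  case (const c)
  show ?case
    by (rule exI[of _ "\<lambda>x h. 0"]) (auto intro: u_algebra.const)
next
  case (coord i)
  show ?case
    by (rule exI[of _ "\<lambda>x h. of_real (h $ i)"])
       (auto intro: u_algebra.const intro!: derivative_eq_intros)
next
  case formula
  show ?case
    by (rule exI, intro conjI allI impI, erule u_inf_formula_has_derivative)
       (unfold divide_inverse, intro u_algebra.intros v_deriv_in_u_algebra w_deriv_in_u_algebra)
next
  case inverse_v
  show ?case
    by (rule exI, intro conjI allI impI, erule inverse_v_has_derivative)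
       (intro u_algebra.intros v_deriv_in_u_algebra u_algebra_minus)
next
  case inverse_w
  show ?case
    by (rule exI, intro conjI allI impI, erule inverse_w_has_derivative)
       (intro u_algebra.intros w_deriv_in_u_algebra u_algebra_minus)
next
  case (add f g)
  then obtain f' g' where
    "\<And>x. x \<noteq> 0 \<Longrightarrow> (f has_derivative f' x) (at x)" "\<And>h. (\<lambda>x. f' x h) \<in> u_algebra L"
    "\<And>x. x \<noteq> 0 \<Longrightarrow> (g has_derivative g' x) (at x)" "\<And>h. (\<lambda>x. g' x h) \<in> u_algebra L"
    by blast
  note fg = this
  show ?case
    by (intro exI[of _ "\<lambda>x h. f' x h + g' x h"] conjI allI impI
        has_derivative_add[OF fg(1) fg(3)] u_algebra.add[OF fg(2) fg(4)])
next
  case (mult f g)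
  then obtain f' g' where
    "\<And>x. x \<noteq> 0 \<Longrightarrow> (f has_derivative f' x) (at x)" "\<And>h. (\<lambda>x. f' x h) \<in> u_algebra L"
    "\<And>x. x \<noteq> 0 \<Longrightarrow> (g has_derivative g' x) (at x)" "\<And>h. (\<lambda>x. g' x h) \<in> u_algebra L"
    by blast
  note fg = this
  have "(\<lambda>x. f x * g' x h + f' x h * g x) \<in> u_algebra L" for h
    by (rule u_algebra.add[OF u_algebra.mult[OF mult.hyps(1) fg(4)]
          u_algebra.mult[OF fg(2) mult.hyps(2)]])
  with has_derivative_mult[OF fg(1) fg(3)] show ?case
    by (intro exI[of _ "\<lambda>x h. f x * g' x h + f' x h * g x"] conjI allI impI)
qed

text \<open>Agreement off the origin is the right hypothesis: \<open>u_inf L\<close> has a separate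
  value at 0, and in the induction the Frechet derivative of \<open>f\<close> is identified with
  \<open>g'\<close> only off the origin.\<close>

lemma u_algebra_C_k_on:
  assumes "g \<in> u_algebra L" "\<And>x. x \<noteq> 0 \<Longrightarrow> f x = g x"
  shows "C_k_on k f (UNIV - {0})"
  using assms
proof (induction k arbitrary: f g)
  case (0 f g)
  obtain g' where "\<And>x. x \<noteq> 0 \<Longrightarrow> (g has_derivative g' x) (at x)"
    using u_algebra_derivative[OF 0(1)] by blast
  then have "isCont f x" if "x \<noteq> 0" for x
    by (rule has_derivative_continuous[OF has_derivative_cong_punctured[OF _ that 0(2)]])
       (use that in simp_all)
  then show ?case
    by (auto intro: continuous_at_imp_continuous_on)
next
  case (Suc k f g)
  obtain g' where g': "\<And>x. x \<noteq> 0 \<Longrightarrow> (g has_derivative g' x) (at x)"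
    "\<And>h. (\<lambda>x. g' x h) \<in> u_algebra L"
    using u_algebra_derivative[OF Suc.prems(1)] by blast
  have f: "(f has_derivative g' x) (at x)" if "x \<noteq> 0" for x
    by (rule has_derivative_cong_punctured[OF g'(1)[OF that] that Suc.prems(2)])
  then have "f differentiable (at x)" if "x \<noteq> 0" for x
    using that by (auto simp: differentiable_def)
  moreover have "C_k_on k (\<lambda>x. frechet_derivative f (at x) h) (UNIV - {0})" for h
    by (rule Suc.IH[OF g'(2)[of h]]) (simp add: frechet_derivative_at[OF f, symmetric])
  ultimately show ?case
    by simp
qed

section \<open>From the formula to \<open>u_inf\<close>, and the value at the origin\<close>

lemma u_inf_eq: "x \<noteq> 0 \<Longrightarrow> u_inf L x = u_inf_formula L x"
  by (simp add: u_inf_def)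

lemma u_inf_has_derivative:
  assumes "x \<noteq> 0"
  shows "(u_inf L has_derivative
    (\<lambda>h. u_inf L x * (of_real ((1 + 2 * L) / 4) * v_deriv x h / v x
           + of_real ((1 - 2 * L) / 4) * w_deriv x h / w x))) (at x)"
  using has_derivative_cong_punctured[OF u_inf_formula_has_derivative[OF assms] assms u_inf_eq]
    u_inf_eq[OF assms] by simp

text \<open>The exponents are real with sum 1/2 and \<open>Ln (w x)\<close> is conjugate to
  \<open>Ln (v x)\<close>, so the real part of the combined exponent is
  \<open>ln (cmod (v x)) / 2\<close> for every \<open>L\<close>. At the origin both sides are 0,
  since \<open>0 powr a = 0\<close>.\<close>

lemma cmod_u_inf_formula: "cmod (u_inf_formula L x) = sqrt (cmod (v x))"
proof (cases "x = 0")
  case False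
  then have v: "v x \<noteq> 0" by (simp add: v_eq_0_iff)
  have "Ln (w x) = cnj (Ln (v x))"
    using v_notin_nonpos_Reals[OF False] by (simp add: w_eq_cnj_v cnj_Ln)
  then have "cmod (u_inf_formula L x) = exp (ln (cmod (v x)) / 2)"
    using v False
    by (simp add: u_inf_formula_def powr_def norm_mult w_eq_0_iff norm_exp_eq_Re exp_add[symmetric]
        del: of_real_divide) (simp add: field_simps)
  also have "\<dots> = sqrt (cmod (v x))"
    using v by (simp add: powr_half_sqrt[symmetric] powr_def)
  finally show ?thesis .
qed (simp add: u_inf_formula_def v_def)

text \<open>The modulus is continuous at the origin with value 0; this makes the \<open>Lim\<close>
  in \<open>u_inf\<close> a genuine limit.\<close>

lemma u_inf_formula_tendsto_0: "(u_inf_formula L \<longlongrightarrow> 0) (at 0)"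
proof -
  have "isCont v 0"
    using v_has_derivative has_derivative_continuous by blast
  then have "(v \<longlongrightarrow> 0) (at 0)"
    using v_eq_0_iff[of 0] by (simp add: isCont_def)
  then have "((\<lambda>x. cmod (u_inf_formula L x)) \<longlongrightarrow> sqrt (cmod 0)) (at 0)"
    unfolding cmod_u_inf_formula by (intro tendsto_intros)
  then show ?thesis
    by (simp add: tendsto_norm_zero_iff)
qed

lemma u_inf_0: "u_inf L 0 = 0"
  using tendsto_Lim[OF _ u_inf_formula_tendsto_0] by (simp add: u_inf_def)

lemma u_inf_tendsto: "(u_inf L \<longlongrightarrow> u_inf L 0) (at 0)"
  unfolding u_inf_0
  by (rule Lim_transform_eventually[OF u_inf_formula_tendsto_0[of L]])
     (auto simp: eventually_at_filter u_inf_eq)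

section \<open>The horizontal gradient of the solution\<close>

text \<open>The fourth power of the Koranyi gauge, which is also \<open>|v|\<^sup>2 = v w\<close>.\<close>

definition koranyi :: "heisenberg \<Rightarrow> real" where
  "koranyi x = ((x$1)^2 + (x$2)^2)^2 + 16 * (x$3)^2"

text \<open>With \<open>z = x\<^sub>1 + \<i> x\<^sub>2\<close>, these are the real and imaginary parts of \<open>z w\<close>.\<close>

definition zw_re :: "heisenberg \<Rightarrow> real" where
  "zw_re x = x$1 * ((x$1)^2 + (x$2)^2) - 4 * x$2 * x$3"

definition zw_im :: "heisenberg \<Rightarrow> real" where
  "zw_im x = x$2 * ((x$1)^2 + (x$2)^2) + 4 * x$1 * x$3"

text \<open>This is |z w|^2 = |z|^2 |w|^2, with |w|^2 = D.\<close>

lemma zw_re_zw_im_squares: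
  "(zw_re x)^2 + (zw_im x)^2 = ((x$1)^2 + (x$2)^2) * koranyi x"
  unfolding zw_re_def zw_im_def koranyi_def by algebra

lemma v_times_w: "v x * w x = of_real (koranyi x)"
  by (simp add: v_def w_def koranyi_def complex_eq_iff power2_eq_square algebra_simps)

lemma koranyi_pos: "x \<noteq> 0 \<Longrightarrow> koranyi x > 0"
  by (auto simp: koranyi_def heisenberg_eq_0_iff sum_power2_eq_zero_iff
      intro: add_pos_nonneg add_nonneg_pos)

lemma cmod_v: "cmod (v x) = sqrt (koranyi x)"
  by (simp add: v_def cmod_def koranyi_def power_mult_distrib)

lemma X1_u_inf:
  assumes "x \<noteq> 0"
  shows "X1 (u_inf L) x = u_inf L x * Complex (zw_re x) (2 * L * zw_im x) / of_real (koranyi x)"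
proof -
  let ?a = "of_real ((1 + 2 * L) / 4) :: complex" and ?b = "of_real ((1 - 2 * L) / 4) :: complex"
  have [simp]: "v x \<noteq> 0" "w x \<noteq> 0"
    using assms by (auto simp: v_eq_0_iff w_eq_0_iff)
  \<comment> \<open>These are X1 v = 2 z and X1 w = 2 cnj z. As (cnj z) v is conjugate to z w, the
    weights \<open>?a\<close> and \<open>?b\<close> leave A with coefficient 1 and \<i> B with
    coefficient 2 L.\<close>
  let ?V = "Complex (2 * x$1) (2 * x$2)" and ?W = "Complex (2 * x$1) (- 2 * x$2)"
  have "X1 (u_inf L) x = u_inf L x * (?a * ?V / v x + ?b * ?W / w x)"
    unfolding X1_eq_derivative[OF u_inf_has_derivative[OF assms]]
    by (simp add: v_deriv_def w_deriv_def axis_def field_simps Complex_eq)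
  also have "?a * ?V / v x + ?b * ?W / w x = (?a * ?V * w x + ?b * ?W * v x) / (v x * w x)"
    by (simp add: field_simps)
  also have "?a * ?V * w x + ?b * ?W * v x = Complex (zw_re x) (2 * L * zw_im x)"
    by (simp add: complex_eq_iff v_def w_def zw_re_def zw_im_def field_simps power2_eq_square)
  finally show ?thesis
    by (simp add: v_times_w)
qed

lemma X2_u_inf:
  assumes "x \<noteq> 0"
  shows "X2 (u_inf L) x = u_inf L x * Complex (zw_im x) (- 2 * L * zw_re x) / of_real (koranyi x)"
proof -
  let ?a = "of_real ((1 + 2 * L) / 4) :: complex" and ?b = "of_real ((1 - 2 * L) / 4) :: complex"
  have [simp]: "v x \<noteq> 0" "w x \<noteq> 0"
    using assms by (auto simp: v_eq_0_iff w_eq_0_iff)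
  \<comment> \<open>Here X2 v = -2 \<i> z and X2 w = 2 \<i> cnj z.\<close>
  let ?V = "Complex (2 * x$2) (- 2 * x$1)" and ?W = "Complex (2 * x$2) (2 * x$1)"
  have "X2 (u_inf L) x = u_inf L x * (?a * ?V / v x + ?b * ?W / w x)"
    unfolding X2_eq_derivative[OF u_inf_has_derivative[OF assms]]
    by (simp add: v_deriv_def w_deriv_def axis_def field_simps Complex_eq)
  also have "?a * ?V / v x + ?b * ?W / w x = (?a * ?V * w x + ?b * ?W * v x) / (v x * w x)"
    by (simp add: field_simps)
  also have "?a * ?V * w x + ?b * ?W * v x = Complex (zw_im x) (- 2 * L * zw_re x)"
    by (simp add: complex_eq_iff v_def w_def zw_re_def zw_im_def field_simps power2_eq_square)
  finally show ?thesis
    by (simp add: v_times_w)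
qed

definition grad_sq :: "real \<Rightarrow> heisenberg \<Rightarrow> real" where
  "grad_sq L x = (1 + 4 * L^2) * ((x$1)^2 + (x$2)^2) * koranyi x powr (- 1 / 2)"

lemma hnorm_sq_hgrad_u_inf:
  assumes "x \<noteq> 0"
  shows "hnorm_sq (hgrad (u_inf L) x) = of_real (grad_sq L x)"
proof -
  let ?D = "koranyi x"
  have D: "?D > 0" using koranyi_pos[OF assms] .
  have u: "(cmod (u_inf L x))^2 = sqrt ?D"
    using assms D by (simp add: u_inf_eq cmod_u_inf_formula cmod_v)
  have "hnorm_sq (hgrad (u_inf L) x) = of_real ((cmod (X1 (u_inf L) x))^2 + (cmod (X2 (u_inf L) x))^2)"
    by (simp only: hnorm_sq_def hgrad_def fst_conv snd_conv complex_norm_square of_real_add)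
  \<comment> \<open>The factors 1 and 2 L fall on A, B in one component and on B, A in the other, so
    the squares add up to c (A^2 + B^2).\<close>
  also have "(cmod (X1 (u_inf L) x))^2 + (cmod (X2 (u_inf L) x))^2 =
      (cmod (u_inf L x))^2 * (1 + 4 * L^2) * ((zw_re x)^2 + (zw_im x)^2) / ?D^2"
    using D by (simp add: X1_u_inf[OF assms] X2_u_inf[OF assms] norm_mult norm_divide
        power_mult_distrib power_divide cmod_power2) (simp add: field_simps)
  also have "\<dots> = (1 + 4 * L^2) * ((x$1)^2 + (x$2)^2) * (sqrt ?D / ?D)"
    unfolding u zw_re_zw_im_squares using D by (simp add: power2_eq_square)
  also have "sqrt ?D / ?D = ?D powr (- 1 / 2)"
    using D powr_diff[of ?D "1/2" 1] by (simp add: powr_half_sqrt)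
  finally show ?thesis by (simp add: grad_sq_def)
qed

section \<open>First derivatives of the squared gradient norm\<close>

lemma koranyi_has_derivative:
  "(koranyi has_derivative
     (\<lambda>h. 4 * ((x$1)^2 + (x$2)^2) * (x$1 * h$1 + x$2 * h$2) + 32 * x$3 * h$3)) (at x)"
  unfolding koranyi_def[abs_def]
  by (rule derivative_eq_intros refl | simp add: fun_eq_iff algebra_simps power2_eq_square)+

lemma koranyi_powr_has_derivative:
  assumes "x \<noteq> 0"
  shows "((\<lambda>y. koranyi y powr s) has_derivative
    (\<lambda>h. s * koranyi x powr s / koranyi x *
      (4 * ((x$1)^2 + (x$2)^2) * (x$1 * h$1 + x$2 * h$2) + 32 * x$3 * h$3))) (at x)"
proof -
  have "((\<lambda>z. z powr s) has_derivative (*) (s * koranyi x powr (s - 1))) (at (koranyi x))"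
    using has_real_derivative_powr[OF koranyi_pos[OF assms]] by (simp add: has_field_derivative_def)
  from has_derivative_compose[OF koranyi_has_derivative this] show ?thesis
    using koranyi_pos[OF assms] by (simp add: powr_diff mult_ac)
qed

text \<open>Since \<open>F\<close> is compared with \<open>f\<close> only off the origin,
  \<open>F\<close> may be the squared norm or a frame derivative of it.\<close>

lemma X1_of_real:
  assumes "(f has_derivative f') (at x)" "x \<noteq> 0" "\<forall>y. y \<noteq> 0 \<longrightarrow> F y = of_real (f y)"
  shows "X1 F x = of_real (f' (axis 1 1) - x$2 / 2 * f' (axis 3 1))"
proof -
  have "(F has_derivative (\<lambda>h. of_real (f' h))) (at x)"
    by (rule has_derivative_cong_punctured[OF has_derivative_of_real[OF assms(1)] assms(2)])
       (use assms(3) in blast)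
  then show ?thesis by (simp add: X1_eq_derivative)
qed

lemma X2_of_real:
  assumes "(f has_derivative f') (at x)" "x \<noteq> 0" "\<forall>y. y \<noteq> 0 \<longrightarrow> F y = of_real (f y)"
  shows "X2 F x = of_real (f' (axis 2 1) + x$1 / 2 * f' (axis 3 1))"
proof -
  have "(F has_derivative (\<lambda>h. of_real (f' h))) (at x)"
    by (rule has_derivative_cong_punctured[OF has_derivative_of_real[OF assms(1)] assms(2)])
       (use assms(3) in blast)
  then show ?thesis by (simp add: X2_eq_derivative)
qed

text \<open>Brings both terms of the product rule for \<open>grad_sq\<close> to the common factor
  D^(-3/2), leaving a polynomial.\<close>

lemma koranyi_powr_minus_half:
  "x \<noteq> 0 \<Longrightarrow> koranyi x powr (- 1 / 2) = koranyi x * koranyi x powr (- 3 / 2)"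
  using powr_mult_base[of "koranyi x" "- 3 / 2"] koranyi_pos[of x] by simp

lemma grad_sq_has_derivative:
  assumes "x \<noteq> 0"
  shows "(grad_sq L has_derivative (\<lambda>h. (1 + 4 * L^2) * koranyi x powr (- 3 / 2) *
    (2 * (x$1 * h$1 + x$2 * h$2) * koranyi x - ((x$1)^2 + (x$2)^2) *
      (2 * ((x$1)^2 + (x$2)^2) * (x$1 * h$1 + x$2 * h$2) + 16 * x$3 * h$3)))) (at x)"
proof -
  have "((\<lambda>y. (1 + 4 * L^2) * ((y$1)^2 + (y$2)^2)) has_derivative
      (\<lambda>h. (1 + 4 * L^2) * (2 * (x$1 * h$1 + x$2 * h$2)))) (at x)"
    by (rule derivative_eq_intros refl | simp add: fun_eq_iff algebra_simps)+
  from has_derivative_mult[OF this koranyi_powr_has_derivative[OF assms, of "- 1 / 2"]]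
  show ?thesis
    unfolding grad_sq_def[abs_def]
    by (rule has_derivative_eq_rhs, unfold koranyi_powr_minus_half[OF assms])
       (use koranyi_pos[OF assms] in \<open>simp add: fun_eq_iff field_simps power2_eq_square\<close>)
qed

text \<open>X1 |z|^2 = 2 x1 and X1 D = 4 A, so the polynomial factor is 2 (x1 D - |z|^2 A), which
  equals 8 x3 B.\<close>

lemma X1_grad_sq:
  assumes "x \<noteq> 0" "\<forall>y. y \<noteq> 0 \<longrightarrow> F y = of_real (grad_sq L y)"
  shows "X1 F x = of_real (8 * (1 + 4 * L^2) * (x$3 * zw_im x * koranyi x powr (- 3 / 2)))"
  unfolding X1_of_real[OF grad_sq_has_derivative[OF assms(1)] assms]
  by (rule arg_cong[where f = of_real])
     (simp add: axis_def zw_im_def koranyi_def; simp add: field_simps power2_eq_square)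

text \<open>Similarly X2 D = 4 B, and x2 D - |z|^2 B = -4 x3 A.\<close>

lemma X2_grad_sq:
  assumes "x \<noteq> 0" "\<forall>y. y \<noteq> 0 \<longrightarrow> F y = of_real (grad_sq L y)"
  shows "X2 F x = of_real (- 8 * (1 + 4 * L^2) * (x$3 * zw_re x * koranyi x powr (- 3 / 2)))"
  unfolding X2_of_real[OF grad_sq_has_derivative[OF assms(1)] assms]
  by (rule arg_cong[where f = of_real])
     (simp add: axis_def zw_re_def koranyi_def; simp add: field_simps power2_eq_square)

section \<open>The commutator on the squared gradient norm\<close>

lemma zw_re_has_derivative:
  "(zw_re has_derivative (\<lambda>h. (3 * (x$1)^2 + (x$2)^2) * h$1
      + (2 * x$1 * x$2 - 4 * x$3) * h$2 - 4 * x$2 * h$3)) (at x)"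
  unfolding zw_re_def[abs_def]
  by (rule derivative_eq_intros refl | simp add: fun_eq_iff algebra_simps power2_eq_square)+

lemma zw_im_has_derivative:
  "(zw_im has_derivative (\<lambda>h. (2 * x$1 * x$2 + 4 * x$3) * h$1
      + ((x$1)^2 + 3 * (x$2)^2) * h$2 + 4 * x$1 * h$3)) (at x)"
  unfolding zw_im_def[abs_def]
  by (rule derivative_eq_intros refl | simp add: fun_eq_iff algebra_simps power2_eq_square)+

lemma bracket_grad_sq:
  assumes "x \<noteq> 0" "\<forall>y. y \<noteq> 0 \<longrightarrow> F y = of_real (grad_sq L y)"
  shows "bracket X1 X2 F x = of_real (- 16 * (1 + 4 * L^2) *
    (((x$1)^2 + (x$2)^2) * x$3 * koranyi x powr (- 3 / 2)))"
proof -
  define c where "c = 1 + 4 * L^2"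
  define M where "M = koranyi x powr (- 3 / 2)"
  let ?r = "(x$1)^2 + (x$2)^2"
  have D: "koranyi x > 0" using koranyi_pos[OF assms(1)] .
  \<comment> \<open>Both first derivatives are a constant times a coordinate, a factor
    \<open>zw_re\<close> or \<open>zw_im\<close>, and D^(-3/2); that middle factor is left
    open.\<close>
  note product = has_derivative_mult_right[OF has_derivative_mult[OF has_derivative_mult[OF
        has_derivative_nth] koranyi_powr_has_derivative[OF assms(1), of "- 3 / 2"]]]
  have X1_F: "\<forall>y. y \<noteq> 0 \<longrightarrow> X1 F y =
      of_real (8 * (1 + 4 * L^2) * (y$3 * zw_im y * koranyi y powr (- 3 / 2)))"
    and X2_F: "\<forall>y. y \<noteq> 0 \<longrightarrow> X2 F y =
      of_real (- 8 * (1 + 4 * L^2) * (y$3 * zw_re y * koranyi y powr (- 3 / 2)))"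
    using X1_grad_sq[OF _ assms(2)] X2_grad_sq[OF _ assms(2)] by blast+
  \<comment> \<open>The three terms come from X1 x3 = -x2/2, X1 A = 3 |z|^2 and X1 D = 4 A.\<close>
  have 1: "X1 (X2 F) x = of_real (- 8 * c * M * (- x$2 / 2 * zw_re x + x$3 * 3 * ?r
      - 6 * x$3 * (zw_re x)^2 / koranyi x))"
    unfolding X1_of_real[OF product[OF zw_re_has_derivative] assms(1) X2_F]
    by (rule arg_cong[where f = of_real])
       (use D in \<open>simp add: axis_def c_def M_def; simp add: zw_re_def field_simps power2_eq_square\<close>)
  \<comment> \<open>Here X2 x3 = x1/2, X2 B = 3 |z|^2 and X2 D = 4 B.\<close>
  have 2: "X2 (X1 F) x = of_real (8 * c * M * (x$1 / 2 * zw_im x + x$3 * 3 * ?r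
      - 6 * x$3 * (zw_im x)^2 / koranyi x))"
    unfolding X2_of_real[OF product[OF zw_im_has_derivative] assms(1) X1_F]
    by (rule arg_cong[where f = of_real])
       (use D in \<open>simp add: axis_def c_def M_def; simp add: zw_im_def field_simps power2_eq_square\<close>)
  have "bracket X1 X2 F x = of_real (- 8 * c * M * ((x$1 * zw_im x - x$2 * zw_re x) / 2
      + 6 * x$3 * ?r - 6 * x$3 * (((zw_re x)^2 + (zw_im x)^2) / koranyi x)))"
    unfolding bracket_def 1 2 of_real_diff[symmetric]
    by (rule arg_cong[where f = of_real]) (use D in \<open>simp add: field_simps\<close>)
  also have "((zw_re x)^2 + (zw_im x)^2) / koranyi x = ?r"
    using D by (simp add: zw_re_zw_im_squares)
  \<comment> \<open>The imaginary part of (cnj z) z w = |z|^2 w, where Im w = 4 x3.\<close>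
  also have "x$1 * zw_im x - x$2 * zw_re x = 4 * x$3 * ?r"
    by (simp add: zw_re_def zw_im_def power2_eq_square algebra_simps)
  also have "- 8 * c * M * (4 * x$3 * ?r / 2 + 6 * x$3 * ?r - 6 * x$3 * ?r) =
      - 16 * (1 + 4 * L^2) * (?r * x$3 * koranyi x powr (- 3 / 2))"
    by (simp add: c_def M_def field_simps)
  finally show ?thesis .
qed

section \<open>Cancellation in the equation\<close>

lemma H_inf_u_inf:
  assumes "q \<noteq> 0"
  shows "H_inf L (u_inf L) q = 0"
proof -
  \<comment> \<open>The common factor: X1, X2 and the bracket of the squared norm are k B, -k A and
    -2 k |z|^2. Pulling out 1/D as well leaves a factor D in the bracket term.\<close>
  define k where "k = 8 * (1 + 4 * L^2) * q$3 * koranyi q powr (- 3 / 2)"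
  have D: "koranyi q > 0" using koranyi_pos[OF assms] .
  have G: "\<forall>y. y \<noteq> 0 \<longrightarrow> hnorm_sq (hgrad (u_inf L) y) = of_real (grad_sq L y)"
    using hnorm_sq_hgrad_u_inf by blast
  have "H_inf L (u_inf L) q = of_real k * u_inf L q / of_real (koranyi q) *
     (of_real (zw_im q) * Complex (zw_re q) (2 * L * zw_im q)
      - of_real (zw_re q) * Complex (zw_im q) (- 2 * L * zw_re q)
      - 2 * \<i> * of_real (L * (((q$1)^2 + (q$2)^2) * koranyi q)))"
    unfolding H_inf_def infinity_Laplacian_def X1_u_inf[OF assms] X2_u_inf[OF assms]
      X1_grad_sq[OF assms G] X2_grad_sq[OF assms G]
      bracket_grad_sq[OF assms G]
    using D by (simp add: k_def field_simps)
  \<comment> \<open>The real parts A B cancel; the imaginary parts are 2 L (A^2 + B^2) and -2 L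
    |z|^2 D.\<close>
  also have "of_real (zw_im q) * Complex (zw_re q) (2 * L * zw_im q)
      - of_real (zw_re q) * Complex (zw_im q) (- 2 * L * zw_re q)
      - 2 * \<i> * of_real (L * (((q$1)^2 + (q$2)^2) * koranyi q)) = 0"
    unfolding zw_re_zw_im_squares[symmetric]
    by (simp add: complex_eq_iff power2_eq_square algebra_simps)
  finally show ?thesis by simp
qed

theorem theorem6p1:
  fixes L :: real
  shows "smooth_on (u_inf L) (UNIV - {0}) \<and>
    (\<forall>q. q \<noteq> 0 \<longrightarrow> H_inf L (u_inf L) q = 0) \<and>
    (u_inf L \<longlongrightarrow> u_inf L 0) (at 0) \<and>
    u_inf L 0 = 0"
  using u_algebra_C_k_on[OF u_algebra.formula u_inf_eq] H_inf_u_inf u_inf_tendsto u_inf_0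
  by (auto simp: smooth_on_def)

end
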